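(* For any regular ordered ST-structure $\mathcal{S}$, one has $\mathsf{ST}(\mathsf{Sc}(\mathcal{S}))\cong\mathcal{S}$ (isomorphism of ordered ST-structures). For any sculpture $em:Q\hookrightarrow B^d$, one has $\mathsf{Sc}(\mathsf{ST}(em))\cong em$ (isomorphism of sculptures).
   Context: Precubical sets: families of disjoint sets $Q_n$ with face maps $s_k,t_k:Q_n\to Q_{n-1}$ ($k=1,\dots,n$) satisfying $\alpha_k\beta_\ell=\beta_{\ell-1}\alpha_k$ for $\alpha,\beta\in\{s,t\}$, $k<\ell$; morphisms commute with face maps. A higher-dimensional automaton (HDA) is a finite precubical set with an initial cell $I\in Q_0$; HDA morphisms are precubical morphisms preserving the initial cell; an embedding is an injective HDA morphism. The bulk $B^d$ is the HDA with $n$-cells the tuples in $\{0,\ast,1\}^d$ with exactly $n$ entries $\ast$, with $s_k$ (resp. $t_k$) replacing the $k$-th occurrence of $\ast$ by $0$ (resp. $1$), and initial cell $(0,\dots,0)$. A sculpture is an HDA $Q$ with an HDA embedding $em:Q\hookrightarrow B^d$. A morphism of sculptures $(Q,em,B^d)\to(Q',em',B^{d'})$ is a pair of HDA morphisms $f:Q\to Q'$, $b:B^d\to B^{d'}$ with $b\circ em=em'\circ f$; it is an isomorphism if $f$ and $b$ are isomorphisms. An ST-structure is a pair $(E,\Sigma)$ with $E$ a finite set of events and $\Sigma$ a set of ST-configurations, i.e. pairs $(S,T)$ with $T\subseteq S\subseteq E$. A morphism $(E,\Sigma)\to(E',\Sigma')$ is a partial function $f:E\rightharpoonup E'$ such that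 for every $(S,T)\in\Sigma$, $f$ restricted to $S$ is total and injective, and $(f(S),f(T))\in\Sigma'$. An ordered ST-structure has a totally ordered event set; morphisms of ordered ST-structures additionally satisfy $f(e_1)<f(e_2)$ whenever $e_1<e_2$ and both are defined; an isomorphism is a bijective morphism. Steps: $(S,T)\to(S\cup\{e\},T)$ for $e\notin S$, and $(S,T)\to(S,T\cup\{e\})$ for $e\in S\setminus T$. $(E,\Sigma)$ is regular if it is rooted ($(\emptyset,\emptyset)\in\Sigma$), connected (every element of $\Sigma$ is reachable from $(\emptyset,\emptyset)$ by a sequence of steps through elements of $\Sigma$), and closed under single events (for $(S,T)\in\Sigma$ and $e\in S\setminus T$, also $(S,T\cup\{e\})\in\Sigma$ and $(S\setminus\{e\},T)\in\Sigma$). For a regular ordered ST-structure $\mathcal S$ on events $e_1<\dots<e_d$, map each $(S,T)\in\Sigma$ to the tuple $x\in\{0,\ast,1\}^d$ with $x_i=0$ if $e_i\notin S$, $x_i=\ast$ if $e_i\in S\setminus T$, $x_i=1$ if $e_i\in T$; the image is a sub-HDA of $B^d$ (closed under faces, containing $(0,\dots,0)$), and $\mathsf{Sc}(\mathcal S)$ denotes this sub-HDA together with its inclusion into $B^d$. For a sculpture $em:Q\hookrightarrow B^d$, $\mathsf{ST}(em)$ is the ordered ST-structure on events $1<\dots<d$ whose configurations are $(\{i:em(q)_i\neq0\},\{i:em(q)_i=1\})$ for $q\in Q$. *)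

theory Defs
  imports Main
begin

section \<open>Precubical sets and higher-dimensional automata\<close>

text \<open>
  As the sets \<open>cells Q n\<close> are pairwise disjoint, the face maps need no dimension index:
  \<open>src Q k\<close> and \<open>tgt Q k\<close> stand for $s_k$ and $t_k$ in all dimensions at once.  Face indices
  are 1-based, and values outside the cells (or for indices out of range) are irrelevant.
\<close>

record 'q precubical =
  cells :: "nat \<Rightarrow> 'q set"
  src :: "nat \<Rightarrow> 'q \<Rightarrow> 'q"
  tgt :: "nat \<Rightarrow> 'q \<Rightarrow> 'q"

definition all_cells :: "('q, 'z) precubical_scheme \<Rightarrow> 'q set" where
  "all_cells Q = (\<Union>n. cells Q n)"

definition precubical_set :: "('q, 'z) precubical_scheme \<Rightarrow> bool" where
  "precubical_set Q \<longleftrightarrow>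
     (\<forall>m n. m \<noteq> n \<longrightarrow> cells Q m \<inter> cells Q n = {}) \<and>
     (\<forall>\<alpha> \<in> {src Q, tgt Q}. \<forall>n. \<forall>k \<in> {1..n}. \<alpha> k ` cells Q n \<subseteq> cells Q (n - 1)) \<and>
     (\<forall>\<alpha> \<in> {src Q, tgt Q}. \<forall>\<beta> \<in> {src Q, tgt Q}. \<forall>n. \<forall>q \<in> cells Q n. \<forall>k l.
        1 \<le> k \<and> k < l \<and> l \<le> n \<longrightarrow> \<alpha> k (\<beta> l q) = \<beta> (l - 1) (\<alpha> k q))"

definition precubical_morphism ::
  "('q \<Rightarrow> 'r) \<Rightarrow> ('q, 'y) precubical_scheme \<Rightarrow> ('r, 'z) precubical_scheme \<Rightarrow> bool" where
  "precubical_morphism f Q R \<longleftrightarrow> precubical_set Q \<and> precubical_set R \<and>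
     (\<forall>n. f ` cells Q n \<subseteq> cells R n) \<and>
     (\<forall>n. \<forall>q \<in> cells Q n. \<forall>k \<in> {1..n}.
        f (src Q k q) = src R k (f q) \<and> f (tgt Q k q) = tgt R k (f q))"

record 'q hda = "'q precubical" +
  initial :: 'q

definition is_hda :: "'q hda \<Rightarrow> bool" where
  "is_hda Q \<longleftrightarrow> precubical_set Q \<and> finite (all_cells Q) \<and> initial Q \<in> cells Q 0"

definition hda_morphism :: "('q \<Rightarrow> 'r) \<Rightarrow> 'q hda \<Rightarrow> 'r hda \<Rightarrow> bool" where
  "hda_morphism f Q R \<longleftrightarrow> is_hda Q \<and> is_hda R \<and>
     precubical_morphism f Q R \<and> f (initial Q) = initial R"

definition hda_embedding :: "('q \<Rightarrow> 'r) \<Rightarrow> 'q hda \<Rightarrow> 'r hda \<Rightarrow> bool" where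
  "hda_embedding f Q R \<longleftrightarrow> hda_morphism f Q R \<and> inj_on f (all_cells Q)"

definition hda_iso :: "('q \<Rightarrow> 'r) \<Rightarrow> 'q hda \<Rightarrow> 'r hda \<Rightarrow> bool" where
  "hda_iso f Q R \<longleftrightarrow> hda_morphism f Q R \<and>
     (\<exists>g. hda_morphism g R Q \<and> (\<forall>q \<in> all_cells Q. g (f q) = q) \<and> (\<forall>r \<in> all_cells R. f (g r) = r))"


section \<open>Bulks and sculptures\<close>

datatype tern = Zero | Star | One

text \<open>\<open>replace_star k a x\<close> replaces the \<open>k\<close>-th occurrence (1-based) of \<open>Star\<close> in \<open>x\<close> by \<open>a\<close>.\<close>

fun replace_star :: "nat \<Rightarrow> tern \<Rightarrow> tern list \<Rightarrow> tern list" where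
  "replace_star k a [] = []"
| "replace_star k a (y # ys) =
     (if y = Star then (if k = 1 then a # ys else y # replace_star (k - 1) a ys)
      else y # replace_star k a ys)"

definition bulk :: "nat \<Rightarrow> tern list hda" where
  "bulk d =
     \<lparr>cells = (\<lambda>n. {x. length x = d \<and> count_list x Star = n}),
      src = (\<lambda>k. replace_star k Zero),
      tgt = (\<lambda>k. replace_star k One),
      initial = replicate d Zero\<rparr>"

record 'q sculpture =
  sc_hda :: "'q hda"
  sc_emb :: "'q \<Rightarrow> tern list"
  sc_dim :: nat

definition is_sculpture :: "'q sculpture \<Rightarrow> bool" where
  "is_sculpture A \<longleftrightarrow> hda_embedding (sc_emb A) (sc_hda A) (bulk (sc_dim A))"

definition sculpture_morphism ::
  "('q \<Rightarrow> 'r) \<Rightarrow> (tern list \<Rightarrow> tern list) \<Rightarrow> 'q sculpture \<Rightarrow> 'r sculpture \<Rightarrow> bool" where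
  "sculpture_morphism f b A A' \<longleftrightarrow> is_sculpture A \<and> is_sculpture A' \<and>
     hda_morphism f (sc_hda A) (sc_hda A') \<and>
     hda_morphism b (bulk (sc_dim A)) (bulk (sc_dim A')) \<and>
     (\<forall>q \<in> all_cells (sc_hda A). b (sc_emb A q) = sc_emb A' (f q))"

definition sculpture_isomorphic :: "'q sculpture \<Rightarrow> 'r sculpture \<Rightarrow> bool" where
  "sculpture_isomorphic A A' \<longleftrightarrow>
     (\<exists>f b. sculpture_morphism f b A A' \<and>
        hda_iso f (sc_hda A) (sc_hda A') \<and> hda_iso b (bulk (sc_dim A)) (bulk (sc_dim A')))"


section \<open>Ordered ST-structures\<close>

record 'e st_structure =
  events :: "'e set"
  confs :: "('e set \<times> 'e set) set"

definition is_st_structure :: "('e, 'z) st_structure_scheme \<Rightarrow> bool" where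
  "is_st_structure X \<longleftrightarrow>
     finite (events X) \<and> (\<forall>(S, T) \<in> confs X. T \<subseteq> S \<and> S \<subseteq> events X)"

definition st_morphism ::
  "('e \<rightharpoonup> 'f) \<Rightarrow> ('e, 'y) st_structure_scheme \<Rightarrow> ('f, 'z) st_structure_scheme \<Rightarrow> bool" where
  "st_morphism f X Y \<longleftrightarrow> is_st_structure X \<and> is_st_structure Y \<and>
     dom f \<subseteq> events X \<and> ran f \<subseteq> events Y \<and>
     (\<forall>(S, T) \<in> confs X. S \<subseteq> dom f \<and> inj_on f S \<and>
        ((\<lambda>e. the (f e)) ` S, (\<lambda>e. the (f e)) ` T) \<in> confs Y)"

text \<open>The relation \<open>ord X\<close> is reflexive on the events; its strict part is \<open>ev_less X\<close>.\<close>

record 'e ordered_st = "'e st_structure" +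
  ord :: "('e \<times> 'e) set"

definition ev_less :: "'e ordered_st \<Rightarrow> 'e \<Rightarrow> 'e \<Rightarrow> bool" where
  "ev_less X e e' \<longleftrightarrow> (e, e') \<in> ord X \<and> e \<noteq> e'"

definition is_ordered_st :: "'e ordered_st \<Rightarrow> bool" where
  "is_ordered_st X \<longleftrightarrow> is_st_structure X \<and> linear_order_on (events X) (ord X)"

definition ordered_st_morphism :: "('e \<rightharpoonup> 'f) \<Rightarrow> 'e ordered_st \<Rightarrow> 'f ordered_st \<Rightarrow> bool" where
  "ordered_st_morphism f X Y \<longleftrightarrow> is_ordered_st X \<and> is_ordered_st Y \<and> st_morphism f X Y \<and>
     (\<forall>e \<in> dom f. \<forall>e' \<in> dom f. ev_less X e e' \<longrightarrow> ev_less Y (the (f e)) (the (f e')))"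

text \<open>
  Bijectivity of a morphism is required both on events (which includes totality) and on
  configurations.  The latter makes the inverse a morphism; without it, the identity from
  $(E,\Sigma)$ to $(E,\Sigma')$ would be an isomorphism for every $\Sigma \subseteq \Sigma'$.
\<close>

definition ordered_st_iso :: "('e \<rightharpoonup> 'f) \<Rightarrow> 'e ordered_st \<Rightarrow> 'f ordered_st \<Rightarrow> bool" where
  "ordered_st_iso f X Y \<longleftrightarrow> ordered_st_morphism f X Y \<and> dom f = events X \<and>
     bij_betw (\<lambda>e. the (f e)) (events X) (events Y) \<and>
     bij_betw (\<lambda>(S, T). ((\<lambda>e. the (f e)) ` S, (\<lambda>e. the (f e)) ` T)) (confs X) (confs Y)"

definition ordered_st_isomorphic :: "'e ordered_st \<Rightarrow> 'f ordered_st \<Rightarrow> bool" where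
  "ordered_st_isomorphic X Y \<longleftrightarrow> (\<exists>f. ordered_st_iso f X Y)"

definition st_step :: "('e set \<times> 'e set) rel" where
  "st_step =
     {((S, T), (insert e S, T)) | S T e. e \<notin> S} \<union>
     {((S, T), (S, insert e T)) | S T e. e \<in> S - T}"

definition rooted :: "('e, 'z) st_structure_scheme \<Rightarrow> bool" where
  "rooted X \<longleftrightarrow> ({}, {}) \<in> confs X"

definition st_connected :: "('e, 'z) st_structure_scheme \<Rightarrow> bool" where
  "st_connected X \<longleftrightarrow>
     (\<forall>c \<in> confs X. (({}, {}), c) \<in> (st_step \<inter> confs X \<times> confs X)\<^sup>*)"

definition closed_single_events :: "('e, 'z) st_structure_scheme \<Rightarrow> bool" where
  "closed_single_events X \<longleftrightarrow>
     (\<forall>(S, T) \<in> confs X. \<forall>e \<in> S - T. (S, insert e T) \<in> confs X \<and> (S - {e}, T) \<in> confs X)"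

definition regular_st :: "('e, 'z) st_structure_scheme \<Rightarrow> bool" where
  "regular_st X \<longleftrightarrow> rooted X \<and> st_connected X \<and> closed_single_events X"


section \<open>The translations\<close>

text \<open>The list $[e_1, \dots, e_d]$ of all events in increasing order.\<close>

definition event_list :: "'e ordered_st \<Rightarrow> 'e list" where
  "event_list X = (THE es. set es = events X \<and> sorted_wrt (ev_less X) es)"

definition conf_tuple :: "'e ordered_st \<Rightarrow> 'e set \<times> 'e set \<Rightarrow> tern list" where
  "conf_tuple X = (\<lambda>(S, T).
     map (\<lambda>e. if e \<notin> S then Zero else if e \<notin> T then Star else One) (event_list X))"

text \<open>
  The construction below makes sense as soon as \<open>X\<close> is rooted and closed under single events;
  connectedness plays no role in it.  This matters for sculptures whose underlying automaton
  has cells that are not reachable from the initial one.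
\<close>

definition Sc :: "'e ordered_st \<Rightarrow> tern list sculpture" where
  "Sc X = (let B = bulk (card (events X)) in
     \<lparr>sc_hda = B\<lparr>cells := \<lambda>n. cells B n \<inter> conf_tuple X ` confs X\<rparr>,
      sc_emb = id,
      sc_dim = card (events X)\<rparr>)"

text \<open>The events are numbered from 1, whereas list positions start at 0.\<close>

definition ST :: "'q sculpture \<Rightarrow> nat ordered_st" where
  "ST A =
     \<lparr>events = {1..sc_dim A},
      confs = (\<lambda>q. ({i \<in> {1..sc_dim A}. sc_emb A q ! (i - 1) \<noteq> Zero},
                    {i \<in> {1..sc_dim A}. sc_emb A q ! (i - 1) = One})) ` all_cells (sc_hda A),
      ord = {(i, j). 1 \<le> i \<and> i \<le> j \<and> j \<le> sc_dim A}\<rparr>"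

end

theory Submission
  imports Defs
begin

text \<open>
  On the configurations of an ordered ST-structure, reading a pair $(S,T)$ as a ternary tuple and
  reading a tuple as a pair are mutually inverse, once the events are identified with their
  positions in the event list.  So for an ST-structure this identification is already the required
  isomorphism.  For a sculpture, the tuple of the configuration of $q$ is $em(q)$, so
  $\mathsf{Sc}(\mathsf{ST}(em))$ is the image of $em$, and any embedding is an isomorphism onto its
  image.
\<close>

section \<open>Bulks\<close>

lemma length_replace_star [simp]: "length (replace_star k a x) = length x"
  by (induction k a x rule: replace_star.induct) auto

lemma count_replace_star:
  assumes "a \<noteq> Star" "1 \<le> k" "k \<le> count_list x Star"
  shows "count_list (replace_star k a x) Star = count_list x Star - 1"
  using assms
proof (induction k a x rule: replace_star.induct)
  case (2 k a y ys)
  show ?case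
  proof (cases "y = Star \<and> k \<noteq> 1")
    case True
    then have "1 \<le> k - 1" "k - 1 \<le> count_list ys Star"
      using "2.prems" by auto
    with True "2.IH"(1) "2.prems" show ?thesis by auto
  qed (use 2 in auto)
qed auto

text \<open>This is the precubical identity of the bulk. Filling the \<open>l\<close>-th star leaves
  the first \<open>k\<close> stars in place, whereas filling the \<open>k\<close>-th one turns the
  \<open>l\<close>-th star into the \<open>(l - 1)\<close>-th.\<close>

lemma replace_star_commute:
  assumes "a \<noteq> Star" "b \<noteq> Star" "1 \<le> k" "k < l"
  shows "replace_star k a (replace_star l b x) = replace_star (l - 1) b (replace_star k a x)"
  using assms(3,4)
proof (induction x arbitrary: k l)
  case (Cons y x)
  show ?case
  proof (cases "y = Star \<and> k \<noteq> 1")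
    \<comment> \<open>When a star at the head is passed over, both indices drop by one in the tail.
      For \<open>k = 1\<close> the head star takes the value \<open>a\<close>, and both sides become
      \<open>a # replace_star (l - 1) b x\<close>.\<close>
    case True
    then have "1 \<le> k - 1" "k - 1 < l - 1"
      using Cons.prems by auto
    from Cons.IH[OF this] True Cons.prems assms(1,2) show ?thesis by auto
  qed (use Cons assms(1,2) in auto)
qed simp

lemma all_cells_bulk: "all_cells (bulk d) = {x. length x = d}"
  by (auto simp: all_cells_def bulk_def)

lemma finite_all_cells_bulk: "finite (all_cells (bulk d))"
proof -
  have "(UNIV :: tern set) = {Zero, Star, One}"
    using tern.exhaust by auto
  then have "finite (UNIV :: tern set)"
    by (metis finite.emptyI finite.insertI)
  from finite_lists_length_eq[OF this, of d] show ?thesis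
    by (simp add: all_cells_bulk)
qed

lemma is_hda_bulk: "is_hda (bulk d)"
proof -
  have "precubical_set (bulk d)"
    unfolding precubical_set_def
    by (auto simp: bulk_def count_replace_star replace_star_commute)
  moreover have "initial (bulk d) \<in> cells (bulk d) 0"
    by (induction d) (auto simp: bulk_def)
  ultimately show ?thesis
    by (simp add: is_hda_def finite_all_cells_bulk)
qed

lemma hda_morphism_id: "is_hda Q \<Longrightarrow> hda_morphism id Q Q"
  by (simp add: hda_morphism_def precubical_morphism_def is_hda_def)

lemma hda_iso_id: "is_hda Q \<Longrightarrow> hda_iso id Q Q"
  unfolding hda_iso_def using hda_morphism_id[of Q] by auto


section \<open>Images of embeddings\<close>

text \<open>The intersection with \<open>cells R n\<close> copies the shape of \<open>Sc\<close>, so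
  that \<open>Sc_ST\<close> below can be an equality of records.\<close>

definition image_hda :: "('q \<Rightarrow> 'r) \<Rightarrow> 'q hda \<Rightarrow> 'r hda \<Rightarrow> 'r hda" where
  "image_hda f Q R = R\<lparr>cells := \<lambda>n. cells R n \<inter> f ` all_cells Q\<rparr>"

context
  fixes f :: "'q \<Rightarrow> 'r" and Q :: "'q hda" and R :: "'r hda"
  assumes emb: "hda_embedding f Q R"
begin

text \<open>As \<open>f\<close> preserves dimensions and distinct dimensions of \<open>R\<close> are
  disjoint, a cell \<open>f q\<close> of dimension \<open>n\<close> can only come from a
  \<open>q\<close> of dimension \<open>n\<close>.\<close>

lemma image_hda_cells: "cells (image_hda f Q R) n = f ` cells Q n"
proof -
  have sub: "f ` cells Q m \<subseteq> cells R m" for m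
    using emb by (auto simp: hda_embedding_def hda_morphism_def precubical_morphism_def)
  have "cells R m \<inter> cells R n = {}" if "m \<noteq> n" for m
    using emb that
    by (auto simp: hda_embedding_def hda_morphism_def precubical_morphism_def precubical_set_def)
  with sub show ?thesis
    by (fastforce simp: image_hda_def all_cells_def)
qed

lemma image_hda_all_cells: "all_cells (image_hda f Q R) = f ` all_cells Q"
  by (auto simp: all_cells_def image_hda_cells)

lemma image_hda_simps:
  "src (image_hda f Q R) = src R" "tgt (image_hda f Q R) = tgt R"
  "initial (image_hda f Q R) = initial R"
  by (simp_all add: image_hda_def)

text \<open>This serves to close the image under the face maps of \<open>R\<close>.\<close>

lemma face_embedding:
  assumes "q \<in> cells Q n" "1 \<le> k" "k \<le> n"
  shows "src R k (f q) = f (src Q k q)" "tgt R k (f q) = f (tgt Q k q)"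
    and "src Q k q \<in> cells Q (n - 1)" "tgt Q k q \<in> cells Q (n - 1)"
proof -
  have "precubical_morphism f Q R" "precubical_set Q"
    using emb by (auto simp: hda_embedding_def hda_morphism_def precubical_morphism_def)
  with assms show "src R k (f q) = f (src Q k q)" "tgt R k (f q) = f (tgt Q k q)"
    and "src Q k q \<in> cells Q (n - 1)" "tgt Q k q \<in> cells Q (n - 1)"
    by (auto simp: precubical_morphism_def precubical_set_def image_subset_iff)
qed

text \<open>Disjointness and the precubical identities are inherited from \<open>R\<close>. Closure
  under faces, finiteness and the initial cell come from \<open>Q\<close> through
  \<open>f\<close>.\<close>

lemma is_hda_image_hda: "is_hda (image_hda f Q R)"
proof -
  have hdas: "is_hda Q" "is_hda R" and init: "f (initial Q) = initial R"
    using emb by (auto simp: hda_embedding_def hda_morphism_def)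
  have R: "precubical_set R"
    using hdas by (simp add: is_hda_def)
  have sub: "cells (image_hda f Q R) n \<subseteq> cells R n" for n
    by (simp add: image_hda_def)
  have "precubical_set (image_hda f Q R)"
    unfolding precubical_set_def image_hda_simps
  proof (intro conjI)
    have "cells R m \<inter> cells R n = {}" if "m \<noteq> n" for m n
      using R that unfolding precubical_set_def by simp
    then show "\<forall>m n. m \<noteq> n \<longrightarrow> cells (image_hda f Q R) m \<inter> cells (image_hda f Q R) n = {}"
      using sub by blast
    show "\<forall>\<alpha>\<in>{src R, tgt R}. \<forall>n. \<forall>k\<in>{1..n}.
        \<alpha> k ` cells (image_hda f Q R) n \<subseteq> cells (image_hda f Q R) (n - 1)"
    proof (intro ballI allI image_subsetI)
      fix \<alpha> n k r
      assume \<alpha>: "\<alpha> \<in> {src R, tgt R}" and "k \<in> {1..n}" and "r \<in> cells (image_hda f Q R) n"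
      then obtain q where q: "r = f q" "q \<in> cells Q n" and k: "1 \<le> k" "k \<le> n"
        by (auto simp: image_hda_cells)
      show "\<alpha> k r \<in> cells (image_hda f Q R) (n - 1)"
        using \<alpha> face_embedding[OF q(2) k] by (auto simp: image_hda_cells q(1))
    qed
    show "\<forall>\<alpha>\<in>{src R, tgt R}. \<forall>\<beta>\<in>{src R, tgt R}. \<forall>n. \<forall>q\<in>cells (image_hda f Q R) n. \<forall>k l.
        1 \<le> k \<and> k < l \<and> l \<le> n \<longrightarrow> \<alpha> k (\<beta> l q) = \<beta> (l - 1) (\<alpha> k q)"
    proof (intro ballI allI impI)
      fix \<alpha> \<beta> n q k l
      assume "\<alpha> \<in> {src R, tgt R}" "\<beta> \<in> {src R, tgt R}" "q \<in> cells (image_hda f Q R) n"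
        and "1 \<le> k \<and> k < l \<and> l \<le> n"
      then show "\<alpha> k (\<beta> l q) = \<beta> (l - 1) (\<alpha> k q)"
        by (intro R[unfolded precubical_set_def, THEN conjunct2, THEN conjunct2, rule_format]
            subsetD[OF sub])
    qed
  qed
  then show ?thesis
    using hdas
    by (auto simp: is_hda_def image_hda_all_cells image_hda_cells image_hda_simps simp flip: init)
qed

lemma hda_embedding_id_image_hda: "hda_embedding id (image_hda f Q R) R"
proof -
  have "is_hda R"
    using emb by (auto simp: hda_embedding_def hda_morphism_def)
  with is_hda_image_hda show ?thesis
    unfolding hda_embedding_def hda_morphism_def precubical_morphism_def
    by (auto simp: is_hda_def image_hda_def)
qed

text \<open>On the image the inverse commutes with faces: a face of \<open>f q\<close> is
  \<open>f\<close> applied to the same face of \<open>q\<close>, and injectivity allows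
  \<open>f\<close> to be cancelled.\<close>

lemma hda_iso_inv_into: "hda_iso (inv_into (all_cells Q) f) (image_hda f Q R) Q"
proof -
  have hdas: "is_hda Q" "is_hda R" and init: "f (initial Q) = initial R"
    and mor: "precubical_morphism f Q R" and inj: "inj_on f (all_cells Q)"
    using emb by (auto simp: hda_embedding_def hda_morphism_def)
  note image = is_hda_image_hda
  have cell: "q \<in> all_cells Q" if "q \<in> cells Q n" for q n
    using that by (auto simp: all_cells_def)
  have inv: "inv_into (all_cells Q) f (f q) = q" if "q \<in> cells Q n" for q n
    using inv_into_f_f[OF inj cell[OF that]] .
  have "precubical_morphism (inv_into (all_cells Q) f) (image_hda f Q R) Q"
    unfolding precubical_morphism_def image_hda_cells image_hda_simps
  proof (intro conjI allI ballI, goal_cases)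
    \<comment> \<open>Case 3 is preservation of dimension; cases 4 and 5 are the source and the
      target faces.\<close>
    case (3 n)
    then show ?case by (auto simp: inv)
  next
    case (4 n r k)
    then obtain q where q: "r = f q" "q \<in> cells Q n" and k: "1 \<le> k" "k \<le> n"
      by auto
    then show ?case
      by (simp only: q(1) face_embedding(1)[OF q(2) k] inv[OF face_embedding(3)[OF q(2) k]]
          inv[OF q(2)])
  next
    case (5 n r k)
    then obtain q where q: "r = f q" "q \<in> cells Q n" and k: "1 \<le> k" "k \<le> n"
      by auto
    then show ?case
      by (simp only: q(1) face_embedding(2)[OF q(2) k] inv[OF face_embedding(4)[OF q(2) k]]
          inv[OF q(2)])
  qed (use hdas image in \<open>simp_all add: is_hda_def\<close>)
  moreover have "inv_into (all_cells Q) f (initial (image_hda f Q R)) = initial Q"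
    using hdas(1) inv[of "initial Q" 0] init by (simp add: is_hda_def image_hda_simps)
  ultimately have "hda_morphism (inv_into (all_cells Q) f) (image_hda f Q R) Q"
    using hdas image by (simp add: hda_morphism_def)
  moreover have "hda_morphism f Q (image_hda f Q R)"
    using hdas image mor init
    by (auto simp: hda_morphism_def precubical_morphism_def is_hda_def image_hda_cells
        image_hda_simps)
  ultimately show ?thesis
    unfolding hda_iso_def image_hda_all_cells using inj
    by (intro conjI exI[of _ f]) (auto simp: f_inv_into_f)
qed

end


section \<open>Event lists\<close>

text \<open>This justifies the \<open>THE\<close> in \<open>event_list\<close>. Counting the
  strictly smaller events embeds the order into the naturals, where strictly increasing lists with a
  given finite set of entries exist and are unique.\<close>

lemma sorted_event_list_unique:
  assumes "is_ordered_st X"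
  shows "\<exists>!es. set es = events X \<and> sorted_wrt (ev_less X) es"
proof -
  let ?E = "events X"
  define rank where "rank e = card {e'. ev_less X e' e}" for e
  have fin: "finite ?E" and lin: "linear_order_on ?E (ord X)"
    using assms by (auto simp: is_ordered_st_def is_st_structure_def)
  have field: "ord X \<subseteq> ?E \<times> ?E" and tr: "trans (ord X)" and anti: "antisym (ord X)"
    and tot: "total_on ?E (ord X)"
    using lin by (auto simp: linear_order_on_def partial_order_on_def preorder_on_def)
  have mono: "rank e < rank e'" if "ev_less X e e'" for e e'
    unfolding rank_def
  proof (rule psubset_card_mono)
    show "finite {d. ev_less X d e'}"
      using field by (auto intro: finite_subset[OF _ fin] simp: ev_less_def)
    \<comment> \<open>Transitivity gives the inclusion and antisymmetry excludes
      \<open>d = e'\<close>. The element \<open>e\<close> lies in the larger set only.\<close>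
    show "{d. ev_less X d e} \<subset> {d. ev_less X d e'}"
      using that transD[OF tr] antisymD[OF anti] unfolding ev_less_def by blast
  qed
  have comparable: "e = e' \<or> ev_less X e e' \<or> ev_less X e' e" if "e \<in> ?E" "e' \<in> ?E" for e e'
    using that tot unfolding total_on_def ev_less_def by blast
  \<comment> \<open>Here \<open>refl\<close> means that \<open>rank\<close> reflects the order, not
    reflexivity.\<close>
  have refl: "ev_less X e e'" if "rank e < rank e'" "e \<in> ?E" "e' \<in> ?E" for e e'
    using comparable[OF that(2,3)] that(1) mono[of e' e] by auto
  have inj: "inj_on rank ?E"
    using comparable mono by (metis inj_onI less_irrefl)
  show ?thesis
  proof (rule ex_ex1I)
    \<comment> \<open>Existence: the sorted list of ranks is pulled back along the inverse of
      \<open>rank\<close>.\<close>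
    define ns where "ns = sorted_list_of_set (rank ` ?E)"
    let ?es = "map (inv_into ?E rank) ns"
    have ns: "set ns = rank ` ?E"
      using fin by (simp add: ns_def)
    have "sorted_wrt (<) ns"
      by (simp add: ns_def)
    then have "sorted_wrt (\<lambda>m n. ev_less X (inv_into ?E rank m) (inv_into ?E rank n)) ns"
      by (rule sorted_wrt_mono_rel[rotated])
        (simp add: ns refl f_inv_into_f inv_into_into)
    moreover have "set ?es = ?E"
      using inj by (simp add: ns image_image)
    ultimately show "\<exists>es. set es = ?E \<and> sorted_wrt (ev_less X) es"
      by (auto simp: sorted_wrt_map intro!: exI[of _ ?es])
  next
    fix es es'
    assume es: "set es = ?E \<and> sorted_wrt (ev_less X) es"
      and es': "set es' = ?E \<and> sorted_wrt (ev_less X) es'"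
    \<comment> \<open>Uniqueness: both lists have the same strictly increasing list of ranks, and
      \<open>rank\<close> is injective on the events.\<close>
    have "sorted_wrt (<) (map rank xs)" if "sorted_wrt (ev_less X) xs" for xs
      using that mono by (auto simp: sorted_wrt_map elim: sorted_wrt_mono_rel[rotated])
    with es es' have "map rank es = map rank es'"
      by (intro strict_sorted_equal) auto
    with es es' inj show "es = es'"
      by (metis Un_absorb inj_on_map_eq_map)
  qed
qed

lemma event_list_props:
  assumes "is_ordered_st X"
  shows "set (event_list X) = events X" "sorted_wrt (ev_less X) (event_list X)"
  using theI'[OF sorted_event_list_unique[OF assms]] by (auto simp: event_list_def)

lemma event_list_eqI:
  assumes "is_ordered_st X" "set es = events X" "sorted_wrt (ev_less X) es"
  shows "event_list X = es"
  using assms sorted_event_list_unique[OF assms(1)] event_list_props[OF assms(1)] by blast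

lemma distinct_event_list:
  assumes "is_ordered_st X"
  shows "distinct (event_list X)"
proof -
  have "distinct xs" if "sorted_wrt (ev_less X) xs" for xs
    using that by (induction xs) (auto simp: ev_less_def)
  with event_list_props[OF assms] show ?thesis by blast
qed

lemma length_event_list:
  assumes "is_ordered_st X"
  shows "length (event_list X) = card (events X)"
  using distinct_card[OF distinct_event_list[OF assms]] event_list_props[OF assms] by simp

lemma is_ordered_st_ST: "is_ordered_st (ST A)"
proof -
  have "linear_order_on (events (ST A)) (ord (ST A))"
    by (auto simp: ST_def linear_order_on_def partial_order_on_def preorder_on_def refl_on_def
        trans_def antisym_def total_on_def)
  then show ?thesis
    by (auto simp: is_ordered_st_def is_st_structure_def ST_def)
qed

lemma confs_ST:
  "confs (ST A) = (\<lambda>q. ({i \<in> {1..sc_dim A}. sc_emb A q ! (i - 1) \<noteq> Zero},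
     {i \<in> {1..sc_dim A}. sc_emb A q ! (i - 1) = One})) ` all_cells (sc_hda A)"
  by (simp add: ST_def)

lemma event_list_ST: "event_list (ST A) = [1..<Suc (sc_dim A)]"
proof (rule event_list_eqI[OF is_ordered_st_ST])
  have "sorted_wrt (<) [1..<Suc (sc_dim A)]"
    by (rule sorted_wrt_upt)
  then show "sorted_wrt (ev_less (ST A)) [1..<Suc (sc_dim A)]"
    by (rule sorted_wrt_mono_rel[rotated]) (auto simp: ev_less_def ST_def)
qed (auto simp: ST_def)


section \<open>From ST-structures to sculptures and back\<close>

text \<open>Every tuple has length \<open>card (events X)\<close>, so it is a bulk cell in the
  dimension given by its number of stars; the intersections in \<open>Sc\<close> lose no
  tuple.\<close>

lemma all_cells_Sc:
  assumes "is_ordered_st X"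
  shows "all_cells (sc_hda (Sc X)) = conf_tuple X ` confs X"
  using length_event_list[OF assms]
  by (auto simp: all_cells_def Sc_def bulk_def conf_tuple_def Let_def)

lemma ST_Sc_isomorphic:
  assumes X: "is_ordered_st X"
  shows "ordered_st_isomorphic (ST (Sc X)) X"
proof -
  define es where "es = event_list X"
  define d where "d = card (events X)"
  \<comment> \<open>The shift turns the event number \<open>i\<close>, counted from 1, into a list
    position. \<open>f\<close> is \<open>g\<close> as a partial map with domain exactly
    \<open>{1..d}\<close>; \<open>h\<close> is its action on configurations and \<open>c\<close>,
    taking preimages, is the candidate inverse.\<close>
  define g where "g i = es ! (i - 1)" for i
  define f where "f i = (if i \<in> {1..d} then Some (g i) else None)" for i
  define h where "h = (\<lambda>(S, T). (g ` S, g ` T))"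
  define c where "c = (\<lambda>(S, T). ({i \<in> {1..d}. g i \<in> S}, {i \<in> {1..d}. g i \<in> T}))"
  have es: "set es = events X" "sorted_wrt (ev_less X) es" "length es = d" "distinct es"
    using event_list_props[OF X] length_event_list[OF X] distinct_event_list[OF X]
    by (auto simp: es_def d_def)
  have dim: "sc_dim (Sc X) = d"
    by (simp add: Sc_def d_def Let_def)
  have emb: "sc_emb (Sc X) = id"
    by (simp add: Sc_def Let_def)
  have less: "ev_less X (g i) (g j)" if "i \<in> {1..d}" "j \<in> {1..d}" "i < j" for i j
    using sorted_wrt_nth_less[OF es(2), of "i - 1" "j - 1"] that es(3) by (simp add: g_def)
  have inj: "inj_on g {1..d}"
    using es(3,4) by (auto simp: inj_on_def g_def nth_eq_iff_index_eq)
  have img: "g ` {1..d} = events X"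
  proof -
    have "(\<lambda>i. i - 1) ` {1..d} = {..<d}"
      by (force simp: image_iff intro: bexI[of _ "Suc _"])
    then have "g ` {1..d} = (!) es ` {..<d}"
      unfolding g_def by (metis image_image)
    then show ?thesis
      using es(1,3) by (auto simp: set_conv_nth)
  qed
  have wf: "T \<subseteq> S \<and> S \<subseteq> events X" if "(S, T) \<in> confs X" for S T
    using X that by (auto simp: is_ordered_st_def is_st_structure_def)
  have confs: "confs (ST (Sc X)) = c ` confs X"
  proof -
    have "({i \<in> {1..d}. conf_tuple X p ! (i - 1) \<noteq> Zero},
          {i \<in> {1..d}. conf_tuple X p ! (i - 1) = One}) = c p" if "p \<in> confs X" for p
    proof -
      obtain S T where p: "p = (S, T)" by fastforce
      have "conf_tuple X p ! (i - 1) = (if g i \<notin> S then Zero else if g i \<notin> T then Star else One)"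
        if "i \<in> {1..d}" for i
      proof -
        have "i - 1 < length (event_list X)"
          using that es(3) by (auto simp: es_def)
        then show ?thesis
          by (simp add: p conf_tuple_def g_def es_def)
      qed
      \<comment> \<open>An entry is \<open>One\<close> when its event lies in both \<open>S\<close>
        and \<open>T\<close>; \<open>T \<subseteq> S\<close> reduces this to membership in
        \<open>T\<close>.\<close>
      then show ?thesis
        using wf[of S T] that by (auto simp: p c_def split: if_splits)
    qed
    then show ?thesis
      unfolding confs_ST all_cells_Sc[OF X] dim emb image_image id_apply
      by (intro image_cong) auto
  qed
  have hc: "h (c p) = p" if "p \<in> confs X" for p
  proof -
    obtain S T where p: "p = (S, T)" by fastforce
    have "g ` {i \<in> {1..d}. g i \<in> A} = A" if "A \<subseteq> events X" for A
      using that by (auto simp flip: img)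
    then show ?thesis
      using wf[of S T] that by (auto simp: p h_def c_def)
  qed
  have dom: "dom f = {1..d}"
    by (auto simp: f_def dom_def)
  have ran: "ran f \<subseteq> events X"
    using img by (auto simp: ran_def f_def split: if_splits)
  have the_f: "the (f i) = g i" if "i \<in> {1..d}" for i
    using that by (simp add: f_def)
  have bij_f: "bij_betw (\<lambda>i. the (f i)) {1..d} (events X)"
    using bij_betw_cong[of "{1..d}" _ g, OF the_f] inj img by (simp add: bij_betw_def)
  have sub: "S \<subseteq> {1..d}" "T \<subseteq> {1..d}" if "(S, T) \<in> confs (ST (Sc X))" for S T
    using that by (auto simp: ST_def dim)
  \<comment> \<open>The restriction to configurations matters: outside \<open>{1..d}\<close> the
    value \<open>the (f i)\<close> is unspecified.\<close>
  have h: "((\<lambda>i. the (f i)) ` S, (\<lambda>i. the (f i)) ` T) = h (S, T)"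
    if "(S, T) \<in> confs (ST (Sc X))" for S T
    using sub[OF that] the_f by (auto simp: h_def intro!: image_cong)
  have events: "events (ST (Sc X)) = {1..d}"
    by (simp add: ST_def dim)
  \<comment> \<open>By \<open>confs\<close> every configuration on the left is some
    \<open>c p\<close>, so \<open>h (c p) = p\<close> yields both inverse laws.\<close>
  have bij: "bij_betw h (confs (ST (Sc X))) (confs X)"
    by (rule bij_betw_byWitness[of _ c]) (auto simp: confs hc)
  have "st_morphism f (ST (Sc X)) X"
    unfolding st_morphism_def
  proof (intro conjI ballI, goal_cases)
    case 1
    then show ?case
      using is_ordered_st_ST[of "Sc X"] by (simp add: is_ordered_st_def)
  next
    case 2
    then show ?case
      using X by (simp add: is_ordered_st_def)
  next
    case (5 p)
    obtain S T where p: "p = (S, T)" by fastforce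
    have conf: "(S, T) \<in> confs (ST (Sc X))"
      using 5 by (simp add: p)
    \<comment> \<open>Morphisms ask for injectivity of the option-valued \<open>f\<close>; it
      follows from injectivity of its composite with \<open>the\<close>.\<close>
    have "inj_on f {1..d}"
      using bij_betw_imp_inj_on[OF bij_f] by (intro inj_on_imageI2[of the]) (simp add: comp_def)
    then have "inj_on f S"
      using sub(1)[OF conf] by (rule inj_on_subset)
    moreover have "h p \<in> confs X"
      using bij_betwE[OF bij] 5 by blast
    ultimately show ?case
      using sub(1)[OF conf] by (simp add: p dom h[OF conf])
  qed (simp_all add: dom ran events)
  moreover have "ev_less X (the (f i)) (the (f j))"
    if "i \<in> dom f" "j \<in> dom f" "ev_less (ST (Sc X)) i j" for i j
    using that less by (auto simp: dom the_f ev_less_def ST_def)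
  ultimately have "ordered_st_morphism f (ST (Sc X)) X"
    by (simp add: ordered_st_morphism_def is_ordered_st_ST X)
  moreover have "bij_betw (\<lambda>i. the (f i)) (events (ST (Sc X))) (events X)"
    unfolding events by (rule bij_f)
  moreover have "bij_betw (\<lambda>(S, T). ((\<lambda>i. the (f i)) ` S, (\<lambda>i. the (f i)) ` T))
      (confs (ST (Sc X))) (confs X)"
    using bij h by (subst bij_betw_cong[of _ _ h]) auto
  ultimately show ?thesis
    unfolding ordered_st_isomorphic_def ordered_st_iso_def
    by (intro exI[of _ f] conjI) (simp_all add: dom events)
qed

text \<open>The two sets determine each entry: \<open>Zero\<close> in neither, \<open>Star\<close>
  in the first only, \<open>One\<close> in both. List position \<open>i\<close> belongs to event
  \<open>i + 1\<close>.\<close>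

lemma conf_tuple_ST:
  assumes "length x = sc_dim A"
  shows "conf_tuple (ST A) ({i \<in> {1..sc_dim A}. x ! (i - 1) \<noteq> Zero},
           {i \<in> {1..sc_dim A}. x ! (i - 1) = One}) = x"
proof (rule nth_equalityI)
  fix i assume "i < length (conf_tuple (ST A) ({i \<in> {1..sc_dim A}. x ! (i - 1) \<noteq> Zero},
           {i \<in> {1..sc_dim A}. x ! (i - 1) = One}))"
  then have "i < sc_dim A"
    by (simp add: conf_tuple_def event_list_ST del: upt_Suc)
  then show "conf_tuple (ST A) ({i \<in> {1..sc_dim A}. x ! (i - 1) \<noteq> Zero},
           {i \<in> {1..sc_dim A}. x ! (i - 1) = One}) ! i = x ! i"
    by (cases "x ! i") (auto simp: conf_tuple_def event_list_ST simp del: upt_Suc)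
qed (use assms in \<open>simp add: conf_tuple_def event_list_ST del: upt_Suc\<close>)

text \<open>By \<open>conf_tuple_ST\<close> the configuration of \<open>q\<close> has the tuple
  \<open>sc_emb A q\<close>, so the round trip replaces the automaton by its image in the
  bulk.\<close>

lemma Sc_ST:
  assumes "is_sculpture A"
  shows "Sc (ST A) =
    \<lparr>sc_hda = image_hda (sc_emb A) (sc_hda A) (bulk (sc_dim A)), sc_emb = id, sc_dim = sc_dim A\<rparr>"
proof -
  have "length (sc_emb A q) = sc_dim A" if "q \<in> all_cells (sc_hda A)" for q
    using assms that
    by (fastforce simp: is_sculpture_def hda_embedding_def hda_morphism_def
        precubical_morphism_def all_cells_def bulk_def)
  then have "conf_tuple (ST A) ` confs (ST A) = sc_emb A ` all_cells (sc_hda A)"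
    unfolding confs_ST image_image by (intro image_cong conf_tuple_ST) auto
  moreover have "card (events (ST A)) = sc_dim A"
    by (simp add: ST_def)
  ultimately show ?thesis
    by (simp add: Sc_def image_hda_def Let_def)
qed

lemma Sc_ST_isomorphic:
  assumes A: "is_sculpture A"
  shows "sculpture_isomorphic (Sc (ST A)) A"
proof -
  let ?Q = "sc_hda A" and ?B = "bulk (sc_dim A)" and ?em = "sc_emb A"
  let ?f = "inv_into (all_cells ?Q) ?em"
  have emb: "hda_embedding ?em ?Q ?B"
    using A by (simp add: is_sculpture_def)
  have iso: "hda_iso ?f (image_hda ?em ?Q ?B) ?Q"
    by (rule hda_iso_inv_into[OF emb])
  have "is_sculpture (Sc (ST A))"
    using hda_embedding_id_image_hda[OF emb] by (simp add: is_sculpture_def Sc_ST[OF A])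
  \<comment> \<open>This is the commuting square: the embedding of the image and the bulk component
    are both \<open>id\<close>.\<close>
  moreover have "x = ?em (?f x)" if "x \<in> all_cells (image_hda ?em ?Q ?B)" for x
    using that by (simp add: image_hda_all_cells[OF emb] f_inv_into_f)
  ultimately have "sculpture_morphism ?f id (Sc (ST A)) A"
    using A iso hda_morphism_id[OF is_hda_bulk]
    by (simp add: sculpture_morphism_def Sc_ST[OF A] hda_iso_def)
  then show ?thesis
    unfolding sculpture_isomorphic_def
    using iso hda_iso_id[OF is_hda_bulk, of "sc_dim A"]
    by (intro exI[of _ ?f] exI[of _ id]) (simp add: Sc_ST[OF A])
qed

theorem theorem3p8:
  fixes X :: "'e ordered_st" and A :: "'q sculpture"
  shows "(is_ordered_st X \<and> regular_st X \<longrightarrow> ordered_st_isomorphic (ST (Sc X)) X) \<and>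
         (is_sculpture A \<longrightarrow> sculpture_isomorphic (Sc (ST A)) A)"
  using ST_Sc_isomorphic Sc_ST_isomorphic by blast

end
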